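(* Let $N$ be a Nijenhuis operator on a BiHom-Lie algebra $(L,[\cdot,\cdot],\alpha,\beta)$ over $\mathbb{C}$, and let $[x,y]_N=[N(x),y]+[x,N(y)]-N[x,y]$ for $x,y\in L$. Then: (1) $(L,[\cdot,\cdot]_N,\alpha,\beta)$ is a BiHom-Lie algebra. (2) The brackets $[\cdot,\cdot]$ and $[\cdot,\cdot]_N$ are compatible: for any $\lambda\in\mathbb{C}$, $[\cdot,\cdot]_\lambda=[\cdot,\cdot]+\lambda[\cdot,\cdot]_N$ is a BiHom-Lie bracket (i.e. $(L,[\cdot,\cdot]_\lambda,\alpha,\beta)$ is a BiHom-Lie algebra). (3) For any integer $k\ge0$, $N^k$ is a Nijenhuis operator on $(L,[\cdot,\cdot]_N,\alpha,\beta)$.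
   Context: A BiHom-Lie algebra is a 4-tuple $(L,[\cdot,\cdot],\alpha,\beta)$ with $L$ a vector space over $\mathbb{C}$, $[\cdot,\cdot]:L\times L\to L$ bilinear, $\alpha,\beta:L\to L$ linear, such that for all $x,y,z\in L$: (i) $\alpha\circ\beta=\beta\circ\alpha$; (ii) $\alpha([x,y])=[\alpha(x),\alpha(y)]$ and $\beta([x,y])=[\beta(x),\beta(y)]$; (iii) $[\beta(x),\alpha(y)]=-[\beta(y),\alpha(x)]$; (iv) $[\beta^2(x),[\beta(y),\alpha(z)]]+[\beta^2(y),[\beta(z),\alpha(x)]]+[\beta^2(z),[\beta(x),\alpha(y)]]=0$. A linear map $N:L\to L$ is a Nijenhuis operator on it if $N\circ\alpha=\alpha\circ N$, $N\circ\beta=\beta\circ N$, and $[N(x),N(y)]=N([N(x),y]+[x,N(y)]-N[x,y])$ for all $x,y\in L$. *)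

theory Defs
  imports Complex_Main
begin

text \<open>
  The underlying complex vector space is a whole type with an explicit scalar multiplication.
\<close>

locale bihom_lie_algebra = vector_space scale
  for scale :: "complex \<Rightarrow> 'a::ab_group_add \<Rightarrow> 'a" +
  fixes bracket :: "'a \<Rightarrow> 'a \<Rightarrow> 'a"
    and \<alpha> \<beta> :: "'a \<Rightarrow> 'a"
  assumes linear_bracket_left: "\<And>y. Vector_Spaces.linear scale scale (\<lambda>x. bracket x y)"
    and linear_bracket_right: "\<And>x. Vector_Spaces.linear scale scale (\<lambda>y. bracket x y)"
    and linear_\<alpha>: "Vector_Spaces.linear scale scale \<alpha>"
    and linear_\<beta>: "Vector_Spaces.linear scale scale \<beta>"
    and \<alpha>_\<beta>_commute: "\<alpha> \<circ> \<beta> = \<beta> \<circ> \<alpha>"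
    and \<alpha>_bracket: "\<And>x y. \<alpha> (bracket x y) = bracket (\<alpha> x) (\<alpha> y)"
    and \<beta>_bracket: "\<And>x y. \<beta> (bracket x y) = bracket (\<beta> x) (\<beta> y)"
    and bihom_skew_symmetry: "\<And>x y. bracket (\<beta> x) (\<alpha> y) = - bracket (\<beta> y) (\<alpha> x)"
    and bihom_jacobi: "\<And>x y z.
          bracket ((\<beta> ^^ 2) x) (bracket (\<beta> y) (\<alpha> z))
        + bracket ((\<beta> ^^ 2) y) (bracket (\<beta> z) (\<alpha> x))
        + bracket ((\<beta> ^^ 2) z) (bracket (\<beta> x) (\<alpha> y)) = 0"

definition nijenhuis_bracket ::
    "('a::ab_group_add \<Rightarrow> 'a \<Rightarrow> 'a) \<Rightarrow> ('a \<Rightarrow> 'a) \<Rightarrow> 'a \<Rightarrow> 'a \<Rightarrow> 'a" where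
  "nijenhuis_bracket bracket N x y = bracket (N x) y + bracket x (N y) - N (bracket x y)"

locale nijenhuis_operator = bihom_lie_algebra scale bracket \<alpha> \<beta>
  for scale :: "complex \<Rightarrow> 'a::ab_group_add \<Rightarrow> 'a"
    and bracket :: "'a \<Rightarrow> 'a \<Rightarrow> 'a"
    and \<alpha> \<beta> :: "'a \<Rightarrow> 'a" +
  fixes N :: "'a \<Rightarrow> 'a"
  assumes linear_N: "Vector_Spaces.linear scale scale N"
    and N_\<alpha>_commute: "N \<circ> \<alpha> = \<alpha> \<circ> N"
    and N_\<beta>_commute: "N \<circ> \<beta> = \<beta> \<circ> N"
    and nijenhuis: "\<And>x y. bracket (N x) (N y)
          = N (bracket (N x) y + bracket x (N y) - N (bracket x y))"

end

theory Submission
  imports Defs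
begin

text \<open>
  Write \<open>[x,y]\<^sub>N\<close> for the deformed bracket, so that the Nijenhuis identity reads
  \<open>[N x, N y] = N [x,y]\<^sub>N\<close>.

  (1) All axioms of the deformed bracket except the Jacobi identity follow termwise, because \<open>N\<close>
  is linear and commutes with \<open>\<alpha>\<close> and \<open>\<beta>\<close>.  For Jacobi, expand \<open>[X,[Y,Z]\<^sub>N]\<^sub>N\<close>
  after replacing \<open>N [Y,Z]\<^sub>N\<close> by \<open>[N Y, N Z]\<close>.  The only terms that still have an \<open>N\<close> inside
  the outer bracket but outside the inner one are
  \<open>- [N X, N [Y,Z]]\<close> and \<open>N [X, N [Y,Z]]\<close>; the Nijenhuis identity rewrites the first one and the
  second one cancels (\<open>iterated_nijenhuis_bracket\<close>).  What is left is a combination of iterated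
  brackets \<open>[X,[Y,Z]]\<close> whose arguments have been moved by \<open>N\<close>, so its cyclic sum is a combination
  of seven instances of the original Jacobi identity, under \<open>N\<^sup>2\<close>, \<open>N\<close> or the identity
  (\<open>nijenhuis_bracket_jacobi\<close>).

  (2) The Nijenhuis torsion of \<open>N\<close> does not change when a multiple of the identity is added to
  \<open>N\<close>, and it scales quadratically.  Hence \<open>id + c N\<close> is again a Nijenhuis operator
  (\<open>nijenhuis_operator_id_plus_scale\<close>), and its deformed bracket is exactly
  \<open>[x,y] + c [x,y]\<^sub>N\<close>.  Compatibility is therefore (1) for \<open>id + c N\<close>.

  (3) Applying \<open>[N x, N y] = N [x,y]\<^sub>N\<close> repeatedly shows that \<open>N\<close> is Nijenhuis for \<open>[x,y]\<^sub>N\<close>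
  as well, so it remains to see that powers of a Nijenhuis operator are Nijenhuis.  The torsion
  polarizes to an expression in two operators that satisfies a cocycle rule under composition in
  each of them as long as the operators commute (\<open>mixed_torsion_comp_left\<close>,
  \<open>mixed_torsion_comp_right\<close>), and two inductions, one per operator, then make it vanish on all
  pairs of powers of \<open>N\<close> (\<open>mixed_torsion_funpow_eq_0\<close>).
\<close>

section \<open>The polarized Nijenhuis torsion\<close>

text \<open>
  For \<open>A = C\<close> this is the torsion of \<open>A\<close>.  The two-operator version is needed since the torsion
  of a product cannot be expressed by the torsions of the factors alone.
\<close>

definition mixed_torsion ::
    "('a::ab_group_add \<Rightarrow> 'a \<Rightarrow> 'a) \<Rightarrow> ('a \<Rightarrow> 'a) \<Rightarrow> ('a \<Rightarrow> 'a) \<Rightarrow> 'a \<Rightarrow> 'a \<Rightarrow> 'a" where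
  "mixed_torsion B A C x y = B (A x) (C y) - A (B x (C y)) - C (B (A x) y) + A (C (B x y))"

lemma mixed_torsion_comp_left:
  fixes B :: "'a::ab_group_add \<Rightarrow> 'a \<Rightarrow> 'a"
  assumes "Modules.additive A" and "A \<circ> C = C \<circ> A"
  shows "mixed_torsion B (A \<circ> A') C x y
    = mixed_torsion B A C (A' x) y + A (mixed_torsion B A' C x y)"
  using assms(2)
  by (simp add: mixed_torsion_def Modules.additive.add[OF assms(1)]
      Modules.additive.diff[OF assms(1)] fun_eq_iff)

lemma mixed_torsion_comp_right:
  fixes B :: "'a::ab_group_add \<Rightarrow> 'a \<Rightarrow> 'a"
  assumes "Modules.additive C" and "A \<circ> C = C \<circ> A"
  shows "mixed_torsion B A (C \<circ> C') x y
    = mixed_torsion B A C x (C' y) + C (mixed_torsion B A C' x y)"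
  using assms(2)
  by (simp add: mixed_torsion_def Modules.additive.add[OF assms(1)]
      Modules.additive.diff[OF assms(1)] fun_eq_iff)

lemma mixed_torsion_funpow_eq_0:
  fixes B :: "'a::ab_group_add \<Rightarrow> 'a \<Rightarrow> 'a"
  assumes additive: "Modules.additive N" and torsion: "\<And>x y. mixed_torsion B N N x y = 0"
  shows "mixed_torsion B (N ^^ j) (N ^^ k) x y = 0"
proof -
  have N_0: "N 0 = 0"
    using additive by (rule Modules.additive.zero)
  have left: "mixed_torsion B (N ^^ j) N x y = 0" for x y
  proof (induction j arbitrary: x y)
    case 0
    show ?case by (simp add: mixed_torsion_def)
  next
    case (Suc j)
    then have "mixed_torsion B (N \<circ> N ^^ j) N x y = 0"
      using mixed_torsion_comp_left[OF additive refl] torsion N_0 by (metis add.right_neutral)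
    then show ?case by (simp only: funpow.simps(2))
  qed
  have commute: "(N ^^ j) \<circ> N = N \<circ> (N ^^ j)"
    by (simp add: fun_eq_iff funpow_swap1)
  show ?thesis
  proof (induction k arbitrary: x y)
    case 0
    show ?case by (simp add: mixed_torsion_def)
  next
    case (Suc k)
    then have "mixed_torsion B (N ^^ j) (N \<circ> N ^^ k) x y = 0"
      using mixed_torsion_comp_right[OF additive commute] left N_0 by (metis add.right_neutral)
    then show ?case by (simp only: funpow.simps(2))
  qed
qed


section \<open>Calculating in a BiHom-Lie algebra with a Nijenhuis operator\<close>

context bihom_lie_algebra
begin

lemmas bracket_add_left = module_hom.add[OF module_hom_linearI[OF linear_bracket_left]]
  and bracket_scale_left = module_hom.scale[OF module_hom_linearI[OF linear_bracket_left]]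
  and bracket_add_right = module_hom.add[OF module_hom_linearI[OF linear_bracket_right]]
  and bracket_diff_right = module_hom.diff[OF module_hom_linearI[OF linear_bracket_right]]
  and bracket_scale_right = module_hom.scale[OF module_hom_linearI[OF linear_bracket_right]]

lemmas \<alpha>_add = module_hom.add[OF module_hom_linearI[OF linear_\<alpha>]]
  and \<alpha>_diff = module_hom.diff[OF module_hom_linearI[OF linear_\<alpha>]]
  and \<alpha>_scale = module_hom.scale[OF module_hom_linearI[OF linear_\<alpha>]]
  and \<beta>_add = module_hom.add[OF module_hom_linearI[OF linear_\<beta>]]
  and \<beta>_diff = module_hom.diff[OF module_hom_linearI[OF linear_\<beta>]]
  and \<beta>_scale = module_hom.scale[OF module_hom_linearI[OF linear_\<beta>]]

lemma linearI:
  assumes "\<And>x y. f (x + y) = f x + f y" and "\<And>c x. f (scale c x) = scale c (f x)"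
  shows "Vector_Spaces.linear scale scale f"
  using assms by (simp add: Vector_Spaces.linear_iff vector_space_axioms)

end

context nijenhuis_operator
begin

lemmas N_add = module_hom.add[OF module_hom_linearI[OF linear_N]]
  and N_diff = module_hom.diff[OF module_hom_linearI[OF linear_N]]
  and N_neg = module_hom.neg[OF module_hom_linearI[OF linear_N]]
  and N_zero = module_hom.zero[OF module_hom_linearI[OF linear_N]]
  and N_scale = module_hom.scale[OF module_hom_linearI[OF linear_N]]

lemma N_\<alpha>: "N (\<alpha> x) = \<alpha> (N x)" and N_\<beta>: "N (\<beta> x) = \<beta> (N x)"
  using N_\<alpha>_commute N_\<beta>_commute by (simp_all add: fun_eq_iff)

lemma N_nijenhuis_bracket: "N (nijenhuis_bracket bracket N x y) = bracket (N x) (N y)"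
  by (simp add: nijenhuis_bracket_def nijenhuis)


section \<open>The deformed bracket\<close>

lemma linear_nijenhuis_bracket_left:
  "Vector_Spaces.linear scale scale (\<lambda>x. nijenhuis_bracket bracket N x y)"
  by (rule linearI) (simp_all add: nijenhuis_bracket_def bracket_add_left bracket_scale_left
      N_add N_scale scale_right_distrib scale_right_diff_distrib)

lemma linear_nijenhuis_bracket_right:
  "Vector_Spaces.linear scale scale (\<lambda>y. nijenhuis_bracket bracket N x y)"
  by (rule linearI) (simp_all add: nijenhuis_bracket_def bracket_add_right bracket_scale_right
      N_add N_scale scale_right_distrib scale_right_diff_distrib)

text \<open>
  No Jacobi identity applies to an outer bracket with argument \<open>N [Y,Z]\<close>.  The expansion
  produces such brackets, and the right-hand side is free of them: the Nijenhuis identity for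
  \<open>[N X, N [Y,Z]]\<close> makes them cancel.
\<close>

lemma iterated_nijenhuis_bracket:
  "nijenhuis_bracket bracket N X (nijenhuis_bracket bracket N Y Z)
    = bracket (N X) (bracket (N Y) Z) + bracket (N X) (bracket Y (N Z))
      + bracket X (bracket (N Y) (N Z))
      - N (bracket (N X) (bracket Y Z) + bracket X (bracket (N Y) Z) + bracket X (bracket Y (N Z)))
      + N (N (bracket X (bracket Y Z)))"
proof -
  have "nijenhuis_bracket bracket N X (nijenhuis_bracket bracket N Y Z)
    = bracket (N X) (nijenhuis_bracket bracket N Y Z) + bracket X (bracket (N Y) (N Z))
      - N (bracket X (nijenhuis_bracket bracket N Y Z))"
    by (simp add: nijenhuis_bracket_def[of bracket N X] N_nijenhuis_bracket)
  then show ?thesis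
    by (simp add: nijenhuis_bracket_def bracket_add_right bracket_diff_right N_add N_diff
        nijenhuis[of X "bracket Y Z"])
qed

lemma nijenhuis_bracket_jacobi:
  "nijenhuis_bracket bracket N ((\<beta> ^^ 2) x) (nijenhuis_bracket bracket N (\<beta> y) (\<alpha> z))
    + nijenhuis_bracket bracket N ((\<beta> ^^ 2) y) (nijenhuis_bracket bracket N (\<beta> z) (\<alpha> x))
    + nijenhuis_bracket bracket N ((\<beta> ^^ 2) z) (nijenhuis_bracket bracket N (\<beta> x) (\<alpha> y)) = 0"
  (is "?L = 0")
proof -
  define J where "J x y z = bracket ((\<beta> ^^ 2) x) (bracket (\<beta> y) (\<alpha> z))
    + bracket ((\<beta> ^^ 2) y) (bracket (\<beta> z) (\<alpha> x))
    + bracket ((\<beta> ^^ 2) z) (bracket (\<beta> x) (\<alpha> y))" for x y z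
  have J_0: "J x y z = 0" for x y z
    unfolding J_def by (rule bihom_jacobi)
  have N_\<beta>2: "N ((\<beta> ^^ 2) x) = (\<beta> ^^ 2) (N x)" for x
    by (simp add: numeral_2_eq_2 N_\<beta>)
  have "?L = J (N x) (N y) z + J (N x) y (N z) + J x (N y) (N z)
      - N (J (N x) y z + J x (N y) z + J x y (N z)) + N (N (J x y z))"
    unfolding iterated_nijenhuis_bracket J_def N_\<beta>2 N_\<alpha> N_\<beta> N_add by (simp add: algebra_simps)
  then show ?thesis
    by (simp add: J_0 N_zero)
qed

lemma bihom_lie_algebra_nijenhuis_bracket:
  "bihom_lie_algebra scale (nijenhuis_bracket bracket N) \<alpha> \<beta>"
proof (intro bihom_lie_algebra.intro bihom_lie_algebra_axioms.intro)
  show "nijenhuis_bracket bracket N (\<beta> x) (\<alpha> y) = - nijenhuis_bracket bracket N (\<beta> y) (\<alpha> x)"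
    for x y
    using bihom_skew_symmetry[of "N x" y] bihom_skew_symmetry[of x "N y"]
      bihom_skew_symmetry[of x y]
    by (simp add: nijenhuis_bracket_def N_\<alpha> N_\<beta> N_neg)
  show "\<alpha> (nijenhuis_bracket bracket N x y) = nijenhuis_bracket bracket N (\<alpha> x) (\<alpha> y)" for x y
    by (simp add: nijenhuis_bracket_def \<alpha>_add \<alpha>_diff \<alpha>_bracket N_\<alpha> flip: N_\<alpha>[of "bracket x y"])
  show "\<beta> (nijenhuis_bracket bracket N x y) = nijenhuis_bracket bracket N (\<beta> x) (\<beta> y)" for x y
    by (simp add: nijenhuis_bracket_def \<beta>_add \<beta>_diff \<beta>_bracket N_\<beta> flip: N_\<beta>[of "bracket x y"])
qed (fact vector_space_axioms linear_nijenhuis_bracket_left linear_nijenhuis_bracket_right linear_\<alpha> linear_\<beta>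
    \<alpha>_\<beta>_commute nijenhuis_bracket_jacobi)+


section \<open>Compatibility of the two brackets\<close>

text \<open>
  The torsion of the identity against any operator vanishes by itself, so the torsion of
  \<open>id + c N\<close> is \<open>c\<^sup>2\<close> times the torsion of \<open>N\<close>.
\<close>

lemma nijenhuis_operator_id_plus_scale:
  "nijenhuis_operator scale bracket \<alpha> \<beta> (\<lambda>x. x + scale c (N x))"
proof (intro nijenhuis_operator.intro nijenhuis_operator_axioms.intro)
  show "Vector_Spaces.linear scale scale (\<lambda>x. x + scale c (N x))"
    by (rule linearI) (simp_all add: N_add N_scale scale_right_distrib scale_left_commute)
  show "(\<lambda>x. x + scale c (N x)) \<circ> \<alpha> = \<alpha> \<circ> (\<lambda>x. x + scale c (N x))"
    by (simp add: fun_eq_iff N_\<alpha> \<alpha>_add \<alpha>_scale)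
  show "(\<lambda>x. x + scale c (N x)) \<circ> \<beta> = \<beta> \<circ> (\<lambda>x. x + scale c (N x))"
    by (simp add: fun_eq_iff N_\<beta> \<beta>_add \<beta>_scale)
  fix x y
  let ?M = "\<lambda>x. x + scale c (N x)"
  show "bracket (?M x) (?M y)
      = ?M (bracket (?M x) y + bracket x (?M y) - ?M (bracket x y))"
    by (simp add: bracket_add_left bracket_add_right bracket_scale_left bracket_scale_right
        N_add N_diff N_scale nijenhuis scale_right_distrib scale_right_diff_distrib)
qed (fact bihom_lie_algebra_axioms)

lemma nijenhuis_bracket_id_plus_scale:
  "nijenhuis_bracket bracket (\<lambda>x. x + scale c (N x)) x y
    = bracket x y + scale c (nijenhuis_bracket bracket N x y)"
  by (simp add: nijenhuis_bracket_def bracket_add_left bracket_add_right bracket_scale_left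
      bracket_scale_right scale_right_distrib scale_right_diff_distrib)

lemma bihom_lie_algebra_pencil:
  "bihom_lie_algebra scale
    (\<lambda>x y. bracket x y + scale c (nijenhuis_bracket bracket N x y)) \<alpha> \<beta>"
  using nijenhuis_operator.bihom_lie_algebra_nijenhuis_bracket[OF
      nijenhuis_operator_id_plus_scale[of c]]
  unfolding nijenhuis_bracket_id_plus_scale[abs_def] .


section \<open>Powers of a Nijenhuis operator\<close>

lemma nijenhuis_operator_nijenhuis_bracket:
  "nijenhuis_operator scale (nijenhuis_bracket bracket N) \<alpha> \<beta> N"
proof (intro nijenhuis_operator.intro nijenhuis_operator_axioms.intro)
  show "nijenhuis_bracket bracket N (N x) (N y)
      = N (nijenhuis_bracket bracket N (N x) y + nijenhuis_bracket bracket N x (N y)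
           - N (nijenhuis_bracket bracket N x y))" for x y
    unfolding N_add N_diff N_nijenhuis_bracket by (rule nijenhuis_bracket_def)
qed (fact bihom_lie_algebra_nijenhuis_bracket linear_N N_\<alpha>_commute N_\<beta>_commute)+

lemma nijenhuis_operator_funpow: "nijenhuis_operator scale bracket \<alpha> \<beta> (N ^^ k)"
proof (intro nijenhuis_operator.intro nijenhuis_operator_axioms.intro)
  show linear_power: "Vector_Spaces.linear scale scale (N ^^ k)"
  proof (rule linearI)
    show "(N ^^ k) (x + y) = (N ^^ k) x + (N ^^ k) y" for x y
      by (induction k) (simp_all add: N_add)
    show "(N ^^ k) (scale c x) = scale c ((N ^^ k) x)" for c x
      by (induction k) (simp_all add: N_scale)
  qed
  show "(N ^^ k) \<circ> \<alpha> = \<alpha> \<circ> (N ^^ k)"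
    by (induction k) (simp_all add: fun_eq_iff N_\<alpha>)
  show "(N ^^ k) \<circ> \<beta> = \<beta> \<circ> (N ^^ k)"
    by (induction k) (simp_all add: fun_eq_iff N_\<beta>)
  fix x y
  have "Modules.additive N"
    by (rule Modules.additive.intro) (rule N_add)
  moreover have "mixed_torsion bracket N N x y = 0" for x y
    by (simp add: mixed_torsion_def nijenhuis N_add N_diff)
  ultimately have "mixed_torsion bracket (N ^^ k) (N ^^ k) x y = 0"
    by (rule mixed_torsion_funpow_eq_0)
  then show "bracket ((N ^^ k) x) ((N ^^ k) y)
      = (N ^^ k) (bracket ((N ^^ k) x) y + bracket x ((N ^^ k) y) - (N ^^ k) (bracket x y))"
    by (simp add: mixed_torsion_def algebra_simps
        module_hom.add[OF module_hom_linearI[OF linear_power]]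
        module_hom.diff[OF module_hom_linearI[OF linear_power]])
qed (fact bihom_lie_algebra_axioms)

end


theorem theorem8p1:
  fixes scale :: "complex \<Rightarrow> 'a::ab_group_add \<Rightarrow> 'a"
    and bracket :: "'a \<Rightarrow> 'a \<Rightarrow> 'a"
    and \<alpha> \<beta> N :: "'a \<Rightarrow> 'a"
  assumes "bihom_lie_algebra scale bracket \<alpha> \<beta>"
    and "nijenhuis_operator scale bracket \<alpha> \<beta> N"
  shows "bihom_lie_algebra scale (nijenhuis_bracket bracket N) \<alpha> \<beta>
    \<and> (\<forall>c :: complex. bihom_lie_algebra scale
         (\<lambda>x y. bracket x y + scale c (nijenhuis_bracket bracket N x y)) \<alpha> \<beta>)
    \<and> (\<forall>k :: nat. nijenhuis_operator scale (nijenhuis_bracket bracket N) \<alpha> \<beta> (N ^^ k))"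
proof -
  interpret nijenhuis_operator scale bracket \<alpha> \<beta> N
    by (rule assms(2))
  show ?thesis
    using bihom_lie_algebra_nijenhuis_bracket bihom_lie_algebra_pencil
      nijenhuis_operator.nijenhuis_operator_funpow[OF nijenhuis_operator_nijenhuis_bracket]
    by blast
qed

end
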